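(* Let $\mathcal T=(V,E,F)$ be an infinite, locally finite triangulation without boundary of a surface, and let $d$ be a PL metric on $\mathcal T$. Then there exists a global solution $u\in C_t^1(V\times[0,\infty))$, defined for all times $t\ge0$, to the extended combinatorial Yamabe flow $$\frac{\mathrm{d}u_i}{\mathrm{d}t}=-\widetilde K_i(u(t)),\qquad u_i(0)=0,\qquad i\in V.$$
   Context: $V,E,F$ are the sets of vertices, edges and (triangular) faces of the triangulation; without boundary means every edge lies in exactly two triangles. A PL metric on $\mathcal T$ is a function $d:E\to\mathbb R_{>0}$ such that for every triangle $\Delta ijk\in F$ the lengths $d_{ij},d_{ik},d_{jk}$ satisfy the (strict) triangle inequalities. For $u:V\to\mathbb R$, $u*d$ is the function on edges given by $(u*d)_{ij}=e^{\frac12(u_i+u_j)}d_{ij}$ (which need not satisfy the triangle inequalities). Extended angles: for $(l_1,l_2,l_3)\in\mathbb R_{>0}^3$ satisfying the strict triangle inequalities, $\widetilde\theta_1,\widetilde\theta_2,\widetilde\theta_3$ are the inner angles of the Euclidean triangle with edge lengths $l_1,l_2,l_3$, with $\widetilde\theta_r$ opposite the edge of length $l_r$. If instead $l_r\ge l_s+l_q$ for some $\{r,s,q\}=\{1,2,3\}$, then $\widetilde\theta_r=\pi$ and $\widetilde\theta_s=\widetilde\theta_q=0$. For $\Delta ijk\in F$ and $u:V\to\mathbb R$, $\widetilde\theta_i^{jk}$ denotes the extended angle at vertex $i$ (opposite edge $jk$) for the edge lengths given by $u*d$, and the extended curvature is $$\widetilde K_i(u)=2\pi-\sum_{\Delta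 ijk\in F}\widetilde\theta_i^{jk}.$$ $u\in C_t^1(V\times[0,\infty))$ means that for each $i\in V$ the function $t\mapsto u_i(t)$ is $C^1$ on $[0,\infty)$. *)

theory Defs
  imports "HOL-Analysis.Analysis"
begin

section \<open>Surfaces\<close>

definition second_countable_space :: "'s topology \<Rightarrow> bool" where
  "second_countable_space S \<longleftrightarrow>
     (\<exists>B. countable B \<and> (\<forall>W\<in>B. openin S W) \<and>
          (\<forall>U. openin S U \<longrightarrow> (\<exists>C\<subseteq>B. \<Union>C = U)))"

text \<open>
  Surfaces are 2-manifolds; a boundary is permitted here (charts take values in the closed half
  plane), so that absence of boundary is a condition on the triangulation. Surfaces need not be
  connected.
\<close>
definition surface :: "'s topology \<Rightarrow> bool" where
  "surface S \<longleftrightarrow>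
     Hausdorff_space S \<and> second_countable_space S \<and>
     (\<forall>p\<in>topspace S. \<exists>U W.
        openin S U \<and> p \<in> U \<and>
        openin (top_of_set {z :: real^2. 0 \<le> z $ 1}) W \<and>
        subtopology S U homeomorphic_space top_of_set W)"

section \<open>Triangulations\<close>

text \<open>Edges and triangles are represented by their sets of vertices.\<close>

definition simplicial_2complex :: "'v set \<Rightarrow> 'v set set \<Rightarrow> 'v set set \<Rightarrow> bool" where
  "simplicial_2complex V E F \<longleftrightarrow>
     (\<forall>e\<in>E. e \<subseteq> V \<and> card e = 2) \<and>
     (\<forall>f\<in>F. f \<subseteq> V \<and> card f = 3 \<and> (\<forall>e\<subseteq>f. card e = 2 \<longrightarrow> e \<in> E))"

definition simplices :: "'v set \<Rightarrow> 'v set set \<Rightarrow> 'v set set \<Rightarrow> 'v set set" where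
  "simplices V E F = (\<lambda>v. {v}) ` V \<union> E \<union> F"

text \<open>The closed geometric simplex spanned by \<open>\<sigma>\<close>, in barycentric coordinates.\<close>
definition geometric_simplex :: "'v set \<Rightarrow> ('v \<Rightarrow> real) set" where
  "geometric_simplex \<sigma> =
     {x. (\<forall>v. 0 \<le> x v) \<and> (\<forall>v. v \<notin> \<sigma> \<longrightarrow> x v = 0) \<and> (\<Sum>v\<in>\<sigma>. x v) = 1}"

text \<open>The weak topology: a set is open iff it meets every closed simplex in a relatively open set.\<close>
definition geometric_realization :: "'v set set \<Rightarrow> ('v \<Rightarrow> real) topology" where
  "geometric_realization K = topology (\<lambda>U.
     U \<subseteq> (\<Union>\<sigma>\<in>K. geometric_simplex \<sigma>) \<and>
     (\<forall>\<sigma>\<in>K. openin (top_of_set (geometric_simplex \<sigma>)) (U \<inter> geometric_simplex \<sigma>)))"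

lemma openin_geometric_realization:
  "openin (geometric_realization K) U \<longleftrightarrow>
     U \<subseteq> (\<Union>\<sigma>\<in>K. geometric_simplex \<sigma>) \<and>
     (\<forall>\<sigma>\<in>K. openin (top_of_set (geometric_simplex \<sigma>)) (U \<inter> geometric_simplex \<sigma>))"
proof -
  let ?P = "\<lambda>U. U \<subseteq> (\<Union>\<sigma>\<in>K. geometric_simplex \<sigma>) \<and>
     (\<forall>\<sigma>\<in>K. openin (top_of_set (geometric_simplex \<sigma>)) (U \<inter> geometric_simplex \<sigma>))"
  have 1: "?P (A \<inter> B)" if "?P A" "?P B" for A B
  proof -
    have "openin (top_of_set (geometric_simplex \<sigma>)) (A \<inter> B \<inter> geometric_simplex \<sigma>)" if "\<sigma> \<in> K" for \<sigma>
    proof -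
      have "A \<inter> B \<inter> geometric_simplex \<sigma> = (A \<inter> geometric_simplex \<sigma>) \<inter> (B \<inter> geometric_simplex \<sigma>)"
        by blast
      then show ?thesis
        using \<open>?P A\<close> \<open>?P B\<close> \<open>\<sigma> \<in> K\<close> openin_Int by metis
    qed
    then show ?thesis using that by blast
  qed
  have 2: "?P (\<Union>\<A>)" if "\<forall>A\<in>\<A>. ?P A" for \<A>
  proof -
    have "openin (top_of_set (geometric_simplex \<sigma>)) (\<Union>\<A> \<inter> geometric_simplex \<sigma>)" if "\<sigma> \<in> K" for \<sigma>
    proof -
      have "\<Union>\<A> \<inter> geometric_simplex \<sigma> = \<Union>((\<lambda>A. A \<inter> geometric_simplex \<sigma>) ` \<A>)"
        by blast
      moreover have "openin (top_of_set (geometric_simplex \<sigma>)) \<dots>"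
        by (rule openin_Union) (use \<open>\<forall>A\<in>\<A>. ?P A\<close> \<open>\<sigma> \<in> K\<close> in blast)
      ultimately show ?thesis by simp
    qed
    then show ?thesis using that by blast
  qed
  have "istopology ?P"
    unfolding istopology_def using 1 2 by blast
  then show ?thesis
    unfolding geometric_realization_def by (simp add: topology_inverse')
qed

definition triangulation_of :: "'v set \<Rightarrow> 'v set set \<Rightarrow> 'v set set \<Rightarrow> 's topology \<Rightarrow> bool" where
  "triangulation_of V E F S \<longleftrightarrow>
     simplicial_2complex V E F \<and>
     geometric_realization (simplices V E F) homeomorphic_space S"

definition locally_finite_complex :: "'v set \<Rightarrow> 'v set set \<Rightarrow> 'v set set \<Rightarrow> bool" where
  "locally_finite_complex V E F \<longleftrightarrow> (\<forall>v\<in>V. finite {\<sigma> \<in> simplices V E F. v \<in> \<sigma>})"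

definition without_boundary :: "'v set set \<Rightarrow> 'v set set \<Rightarrow> bool" where
  "without_boundary E F \<longleftrightarrow> (\<forall>e\<in>E. card {f \<in> F. e \<subseteq> f} = 2)"

section \<open>PL metrics and conformal change\<close>

definition PL_metric :: "'v set set \<Rightarrow> 'v set set \<Rightarrow> ('v set \<Rightarrow> real) \<Rightarrow> bool" where
  "PL_metric E F d \<longleftrightarrow>
     (\<forall>e\<in>E. 0 < d e) \<and>
     (\<forall>i j k. {i, j, k} \<in> F \<longrightarrow> d {i, j} < d {i, k} + d {j, k})"

text \<open>On an edge \<open>e = {i, j}\<close> the sum is \<open>u i + u j\<close>.\<close>
definition conformal_change :: "('v \<Rightarrow> real) \<Rightarrow> ('v set \<Rightarrow> real) \<Rightarrow> 'v set \<Rightarrow> real" where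
  "conformal_change u d e = exp (1/2 * (\<Sum>v\<in>e. u v)) * d e"

section \<open>Extended angles\<close>

text \<open>The angle at \<open>A\<close> of the triangle \<open>A B C\<close>.\<close>
definition vertex_angle :: "real^2 \<Rightarrow> real^2 \<Rightarrow> real^2 \<Rightarrow> real" where
  "vertex_angle A B C = arccos (((B - A) \<bullet> (C - A)) / (norm (B - A) * norm (C - A)))"

text \<open>
  The inner angle opposite the side of length \<open>a\<close> in a Euclidean triangle with side lengths
  \<open>a\<close>, \<open>b\<close>, \<open>c\<close>.
\<close>
definition inner_angle :: "real \<Rightarrow> real \<Rightarrow> real \<Rightarrow> real" where
  "inner_angle a b c =
     (THE \<theta>. \<exists>A B C. dist B C = a \<and> dist A C = b \<and> dist A B = c \<and> \<theta> = vertex_angle A B C)"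

definition extended_angle :: "real \<Rightarrow> real \<Rightarrow> real \<Rightarrow> real" where
  "extended_angle a b c =
     (if a \<ge> b + c then pi
      else if b \<ge> a + c \<or> c \<ge> a + b then 0
      else inner_angle a b c)"

lemma vertex_angle_cosine_rule:
  assumes "dist B C = a" "dist A C = b" "dist A B = c"
  shows "vertex_angle A B C = arccos ((b\<^sup>2 + c\<^sup>2 - a\<^sup>2) / (2 * b * c))"
proof -
  have "norm (B - A) = c" "norm (C - A) = b" "norm ((B - A) - (C - A)) = a"
    using assms by (simp_all add: dist_norm norm_minus_commute)
  then have "(B - A) \<bullet> (C - A) = (b\<^sup>2 + c\<^sup>2 - a\<^sup>2) / 2"
    by (simp only: dot_norm_neg) (simp add: algebra_simps)
  moreover have "norm (B - A) = c" "norm (C - A) = b"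
    using assms by (simp_all add: dist_norm norm_minus_commute)
  ultimately show ?thesis
    by (simp only: vertex_angle_def divide_divide_eq_left mult_ac)
qed

lemma triangle_exists:
  assumes "0 < b" "0 < c" "a < b + c" "b < a + c" "c < a + b"
  shows "\<exists>A B C :: real^2. dist B C = a \<and> dist A C = b \<and> dist A B = c"
proof -
  have a: "0 < a" using assms by linarith
  define x where "x = (b\<^sup>2 + c\<^sup>2 - a\<^sup>2) / (2 * c)"
  have "\<bar>b\<^sup>2 + c\<^sup>2 - a\<^sup>2\<bar> \<le> 2 * b * c"
  proof -
    have "a\<^sup>2 \<le> (b + c)\<^sup>2" using a assms by (intro power_mono) auto
    moreover have "(b - c)\<^sup>2 \<le> a\<^sup>2"
      using a assms by (simp add: abs_le_square_iff[symmetric])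
    ultimately show ?thesis by (auto simp: power2_eq_square algebra_simps)
  qed
  then have "\<bar>x\<bar> \<le> b"
    using assms by (simp add: x_def abs_divide divide_le_eq algebra_simps)
  then have xb: "x\<^sup>2 \<le> b\<^sup>2" using assms by (simp add: abs_le_square_iff[symmetric])
  define y where "y = sqrt (b\<^sup>2 - x\<^sup>2)"
  have y: "y\<^sup>2 = b\<^sup>2 - x\<^sup>2" using xb by (simp add: y_def)
  have "2 * c * x = b\<^sup>2 + c\<^sup>2 - a\<^sup>2" using assms by (simp add: x_def)
  then have "(c - x)\<^sup>2 + y\<^sup>2 = a\<^sup>2" unfolding y by (simp add: power2_eq_square algebra_simps)
  then have "dist (vector [c, 0] :: real^2) (vector [x, y]) = a"
    using a by (simp add: dist_vec_def L2_set_def sum_2 dist_real_def)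
  moreover have "dist (0 :: real^2) (vector [x, y]) = b"
    using y assms by (simp add: dist_vec_def L2_set_def sum_2 dist_real_def)
  moreover have "dist (0 :: real^2) (vector [c, 0]) = c"
    using assms by (simp add: dist_vec_def L2_set_def sum_2 dist_real_def)
  ultimately show ?thesis by blast
qed

lemma inner_angle_cosine_rule:
  assumes "0 < b" "0 < c" "a < b + c" "b < a + c" "c < a + b"
  shows "inner_angle a b c = arccos ((b\<^sup>2 + c\<^sup>2 - a\<^sup>2) / (2 * b * c))"
  unfolding inner_angle_def
  by (rule the_equality) (use triangle_exists[OF assms] vertex_angle_cosine_rule in metis)+

lemma extended_angle_commute:
  assumes "0 < b" "0 < c"
  shows "extended_angle a b c = extended_angle a c b"
  using assms
  by (auto simp: extended_angle_def inner_angle_cosine_rule not_le add.commute mult.commute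
      mult.left_commute)

section \<open>Extended curvature\<close>

text \<open>
  The extended angle at the vertex \<open>i\<close> of the triangle \<open>f = {i, j, k}\<close>, for the edge lengths \<open>l\<close>.
  The value does not depend on which of the two remaining vertices is called \<open>j\<close>.
\<close>
definition corner_angle :: "('v set \<Rightarrow> real) \<Rightarrow> 'v set \<Rightarrow> 'v \<Rightarrow> real" where
  "corner_angle l f i =
     (THE \<theta>. \<exists>j k. f = {i, j, k} \<and> \<theta> = extended_angle (l {j, k}) (l {i, k}) (l {i, j}))"

lemma corner_angle_eq:
  assumes "card {i, j, k} = 3" "0 < l {i, k}" "0 < l {i, j}"
  shows "corner_angle l {i, j, k} i = extended_angle (l {j, k}) (l {i, k}) (l {i, j})"
  unfolding corner_angle_def
proof (rule the_equality)
  have d: "i \<noteq> j" "i \<noteq> k" "j \<noteq> k"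
    using assms(1) by (auto simp: card_insert_if split: if_splits)
  fix \<theta>
  assume "\<exists>j' k'. {i, j, k} = {i, j', k'} \<and> \<theta> = extended_angle (l {j', k'}) (l {i, k'}) (l {i, j'})"
  then obtain j' k' where *: "{i, j, k} = {i, j', k'}"
    and \<theta>: "\<theta> = extended_angle (l {j', k'}) (l {i, k'}) (l {i, j'})" by blast
  have "(j' = j \<and> k' = k) \<or> (j' = k \<and> k' = j)"
    using * d by (metis insertE insertI1 insertI2 singletonD)
  then show "\<theta> = extended_angle (l {j, k}) (l {i, k}) (l {i, j})"
    using \<theta> extended_angle_commute[OF assms(2,3)] by (auto simp: insert_commute)
qed blast

definition extended_curvature ::
    "'v set set \<Rightarrow> ('v set \<Rightarrow> real) \<Rightarrow> ('v \<Rightarrow> real) \<Rightarrow> 'v \<Rightarrow> real" where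
  "extended_curvature F d u i =
     2 * pi - (\<Sum>f\<in>{f \<in> F. i \<in> f}. corner_angle (conformal_change u d) f i)"

section \<open>The flow\<close>

text \<open>At the endpoint \<open>0\<close> derivatives are one-sided.\<close>
definition C1_on_nonneg :: "(real \<Rightarrow> real) \<Rightarrow> bool" where
  "C1_on_nonneg g \<longleftrightarrow>
     (\<exists>g'. (\<forall>t\<ge>0. (g has_real_derivative g' t) (at t within {0..})) \<and> continuous_on {0..} g')"

definition global_extended_Yamabe_flow ::
    "'v set \<Rightarrow> 'v set set \<Rightarrow> ('v set \<Rightarrow> real) \<Rightarrow> ('v \<Rightarrow> real \<Rightarrow> real) \<Rightarrow> bool" where
  "global_extended_Yamabe_flow V F d u \<longleftrightarrow>
     (\<forall>i\<in>V. C1_on_nonneg (u i) \<and> u i 0 = 0 \<and>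
        (\<forall>t\<ge>0. (u i has_real_derivative - extended_curvature F d (\<lambda>j. u j t) i)
                  (at t within {0..})))"

end

theory Submission
  imports Defs
begin

text \<open>
  Read on the product space \<open>'v \<Rightarrow> real\<close>, the flow is an autonomous equation \<open>x' = G x\<close> of
  which each coordinate \<open>G x i\<close> is bounded in \<open>x\<close> and continuous for the product topology:
  by local finiteness, the extended curvature at \<open>i\<close> is a finite sum of extended angles, every
  angle lies in \<open>[0, pi]\<close>, and every angle depends continuously on the three edge lengths, even
  where the triangle inequalities fail. The last point holds because the extended angle is the
  arccosine of the cosine-rule expression truncated to \<open>[-1, 1]\<close>
  (\<open>extended_angle_eq_arccos_clamp\<close>).

  The arccosine has infinite slope at \<open>-1\<close> and \<open>1\<close>, that is, at degenerate triangles, so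
  the field need not be locally Lipschitz and Picard iteration does not apply; the solution comes from a compactness argument of Peano's type (\<open>bounded_coordinates_global_solution\<close>).
  Euler's broken paths with step sizes tending to \<open>0\<close> are confined, at each time and in each
  coordinate, to an interval independent of the step. By Tychonoff's theorem they have a cluster
  point in the product of these intervals, that is, a limit at all times and all coordinates along
  one filter finer than \<open>sequentially\<close>. No diagonal sequence is taken. Since continuity of
  \<open>G x i\<close> only involves finitely many coordinates at a time, and those coordinates of the broken
  paths move at a speed bounded independently of the step, the slope of the paths in coordinate
  \<open>i\<close> is nearly \<open>G\<close> of the limit throughout a short time interval. This estimate survives
  the limit and says that the limit is differentiable with the right derivative. Boundedness of
  each coordinate of \<open>G\<close> is what makes the solution global.
\<close>

section \<open>Product topology\<close>

text \<open>Boxes restricting finitely many coordinates form a basis of the product topology.\<close>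
lemma continuous_on_product_finite_coordinates:
  fixes g :: "('v \<Rightarrow> real) \<Rightarrow> real"
  assumes "continuous_on UNIV g" "0 < e"
  obtains J \<delta> where "finite J" "0 < \<delta>"
    "\<forall>y. (\<forall>j\<in>J. \<bar>y j - x j\<bar> < \<delta>) \<longrightarrow> \<bar>g y - g x\<bar> < e"
proof -
  let ?A = "{y. \<bar>g y - g x\<bar> < e}"
  have "open ?A"
    by (intro open_Collect_less continuous_intros assms)
  then have "openin (product_topology (\<lambda>_. euclidean) UNIV) ?A"
    by (simp add: euclidean_product_topology)
  moreover have "x \<in> ?A" using assms by simp
  ultimately obtain X where X: "x \<in> PiE UNIV X" "\<And>j. open (X j)"
      "finite {j. X j \<noteq> UNIV}" "PiE UNIV X \<subseteq> ?A"
    using product_topology_open_contains_basis[of "\<lambda>_. euclidean" UNIV ?A x] by auto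
  define J where "J = {j. X j \<noteq> UNIV}"
  have "\<exists>r>0. \<forall>z. \<bar>z - x j\<bar> < r \<longrightarrow> z \<in> X j" for j
    using X(1,2) open_dist[of "X j"] by (auto simp: PiE_UNIV_domain dist_real_def)
  then obtain r where r: "\<And>j. 0 < r j" "\<And>j z. \<bar>z - x j\<bar> < r j \<Longrightarrow> z \<in> X j"
    by metis
  define \<delta> where "\<delta> = Min (insert 1 (r ` J))"
  have J: "finite J" using X(3) by (simp add: J_def)
  have "\<bar>g y - g x\<bar> < e" if y: "\<forall>j\<in>J. \<bar>y j - x j\<bar> < \<delta>" for y
  proof -
    have "y j \<in> X j" for j
    proof (cases "j \<in> J")
      case True
      then have "\<delta> \<le> r j" using J by (simp add: \<delta>_def)
      then show ?thesis using y True by (intro r(2)) force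
    qed (simp add: J_def)
    then show ?thesis using X(4) by auto
  qed
  moreover have "0 < \<delta>" using J r(1) by (simp add: \<delta>_def)
  ultimately show ?thesis using that J by blast
qed

text \<open>
  Tychonoff's theorem for a sequence of functions. The index set \<open>'p\<close> may be uncountable, so
  there need not be a convergent subsequence; a filter on the indices takes its place.
\<close>
lemma pointwise_bounded_cluster_filter:
  fixes W :: "nat \<Rightarrow> 'p \<Rightarrow> real"
  assumes "\<And>n p. \<bar>W n p\<bar> \<le> B p"
  obtains \<F> w where "\<F> \<le> sequentially" "\<F> \<noteq> bot" "\<And>p. ((\<lambda>n. W n p) \<longlongrightarrow> w p) \<F>"
proof -
  let ?K = "PiE UNIV (\<lambda>p. {- B p .. B p})"
  have "compactin (product_topology (\<lambda>_. euclidean) UNIV) ?K"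
    by (simp add: compactin_PiE)
  then have "compact ?K"
    by (simp add: euclidean_product_topology)
  moreover have "W n \<in> ?K" for n
  proof -
    have "- B p \<le> W n p \<and> W n p \<le> B p" for p
      using assms[of n p] by linarith
    then show ?thesis by (auto simp: PiE_iff)
  qed
  then have "eventually (\<lambda>y. y \<in> ?K) (filtermap W sequentially)"
    unfolding eventually_filtermap by (intro always_eventually allI)
  moreover have "filtermap W sequentially \<noteq> bot"
    by (simp add: filtermap_bot_iff)
  ultimately obtain w where w: "inf (nhds w) (filtermap W sequentially) \<noteq> bot"
    unfolding compact_filter by metis
  define \<F> where "\<F> = inf (filtercomap W (nhds w)) sequentially"
  have "\<F> \<noteq> bot"
  proof
    assume "\<F> = bot"
    then have "eventually (\<lambda>_. False) \<F>" by simp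
    then obtain P Q where "eventually P (filtercomap W (nhds w))" "eventually Q sequentially"
      and PQ: "\<And>n. P n \<Longrightarrow> Q n \<Longrightarrow> False"
      unfolding \<F>_def eventually_inf by blast
    then obtain R where R: "eventually R (nhds w)" "\<And>n. R (W n) \<Longrightarrow> P n"
      unfolding eventually_filtercomap by blast
    have "eventually (\<lambda>y. \<not> R y) (filtermap W sequentially)"
      unfolding eventually_filtermap
      using \<open>eventually Q sequentially\<close> by eventually_elim (use R PQ in blast)
    then have "eventually (\<lambda>_. False) (inf (nhds w) (filtermap W sequentially))"
      unfolding eventually_inf using R(1) by blast
    then show False using w by (simp add: eventually_False)
  qed
  moreover have "((\<lambda>n. W n p) \<longlongrightarrow> w p) \<F>" for p
  proof -
    have "(W \<longlongrightarrow> w) \<F>"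
      unfolding \<F>_def by (rule filterlim_mono[OF filterlim_filtercomap]) auto
    moreover have "continuous_on UNIV (\<lambda>y::'p \<Rightarrow> real. y p)"
      by simp
    ultimately show ?thesis
      using continuous_on_tendsto_compose[of UNIV "\<lambda>y. y p" W w \<F>] by simp
  qed
  moreover have "\<F> \<le> sequentially" by (simp add: \<F>_def)
  ultimately show ?thesis using that by blast
qed

section \<open>Euler's broken paths\<close>

primrec euler :: "(('v \<Rightarrow> real) \<Rightarrow> 'v \<Rightarrow> real) \<Rightarrow> ('v \<Rightarrow> real) \<Rightarrow> real \<Rightarrow> nat \<Rightarrow> 'v \<Rightarrow> real" where
  "euler G x0 h 0 = x0"
| "euler G x0 h (Suc k) = (\<lambda>i. euler G x0 h k i + h * G (euler G x0 h k) i)"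

lemma euler_slope_forward:
  assumes "m \<le> p" "0 \<le> h"
    and "\<And>k. m \<le> k \<Longrightarrow> k < p \<Longrightarrow> \<bar>G (euler G x0 h k) i - g\<bar> \<le> \<epsilon>"
  shows "\<bar>euler G x0 h p i - euler G x0 h m i - h * (real p - real m) * g\<bar>
          \<le> \<epsilon> * (h * (real p - real m))"
  using assms(1,3)
proof (induction p rule: dec_induct)
  case (step n)
  let ?e = "euler G x0 h"
  have "\<bar>?e n i - ?e m i - h * (real n - real m) * g\<bar> \<le> \<epsilon> * (h * (real n - real m))"
    using step by simp
  moreover have "\<bar>h * (G (?e n) i - g)\<bar> \<le> \<epsilon> * h"
    using step(1) mult_left_mono[OF step.prems[of n] \<open>0 \<le> h\<close>] \<open>0 \<le> h\<close>
    by (simp add: abs_mult mult.commute[of \<epsilon>])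
  ultimately show ?case
    by (simp add: algebra_simps)
qed simp

text \<open>
  If the field is close to \<open>g\<close> at all grid points between two times, the broken path between
  these times has nearly slope \<open>g\<close>. The case \<open>g = 0\<close> is a Lipschitz bound.
\<close>
lemma euler_slope:
  assumes "0 \<le> h"
    and "\<And>k. min m p \<le> k \<Longrightarrow> k < max m p \<Longrightarrow> \<bar>G (euler G x0 h k) i - g\<bar> \<le> \<epsilon>"
  shows "\<bar>euler G x0 h p i - euler G x0 h m i - h * (real p - real m) * g\<bar>
          \<le> \<epsilon> * (h * \<bar>real p - real m\<bar>)"
proof (cases "m \<le> p")
  case True
  then show ?thesis
    using euler_slope_forward[OF True \<open>0 \<le> h\<close>, of G x0 i g \<epsilon>] assms(2) by simp
next
  case False
  then have "p \<le> m" by simp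
  moreover have "\<bar>euler G x0 h p i - euler G x0 h m i - h * (real p - real m) * g\<bar>
     = \<bar>euler G x0 h m i - euler G x0 h p i - h * (real m - real p) * g\<bar>"
    by (subst abs_minus_commute) (simp add: algebra_simps)
  ultimately show ?thesis
    using euler_slope_forward[OF \<open>p \<le> m\<close> \<open>0 \<le> h\<close>, of G x0 i g \<epsilon>] assms(2) by simp
qed

lemma grid_index_bounds:
  assumes "0 \<le> t" "0 < h"
  shows "h * real (nat \<lfloor>t / h\<rfloor>) \<le> t" "t < h * real (nat \<lfloor>t / h\<rfloor>) + h"
proof -
  have "real (nat \<lfloor>t / h\<rfloor>) = real_of_int \<lfloor>t / h\<rfloor>"
    using assms by simp
  moreover have "real_of_int \<lfloor>t / h\<rfloor> * h \<le> t"
    by (rule floor_divide_lower[OF assms(2)])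
  moreover have "t < (real_of_int \<lfloor>t / h\<rfloor> + 1) * h"
    by (rule floor_divide_upper[OF assms(2)])
  ultimately show "h * real (nat \<lfloor>t / h\<rfloor>) \<le> t" "t < h * real (nat \<lfloor>t / h\<rfloor>) + h"
    by (simp_all add: algebra_simps)
qed

text \<open>
  The slope estimate on a short time interval. It is uniform in the step size, because the
  finitely many coordinates on which \<open>G x i\<close> depends near \<open>x\<close> have bounded speed: starting
  near \<open>x\<close>, they stay near \<open>x\<close> for a time independent of \<open>h\<close>.
\<close>
lemma euler_local_slope:
  fixes G :: "('v \<Rightarrow> real) \<Rightarrow> 'v \<Rightarrow> real"
  assumes "continuous_on UNIV (\<lambda>y. G y i)"
    and bound: "\<And>y j. \<bar>G y j\<bar> \<le> C j"
    and "0 < \<epsilon>"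
  obtains J \<delta> \<eta> where "finite J" "0 < \<delta>" "0 < \<eta>"
    "\<forall>h s t. 0 < h \<and> h \<le> \<eta> \<and> 0 \<le> s \<and> 0 \<le> t \<and> \<bar>t - s\<bar> \<le> \<eta> \<and>
       (\<forall>j\<in>J. \<bar>euler G x0 h (nat \<lfloor>s / h\<rfloor>) j - x j\<bar> < \<delta>) \<longrightarrow>
       \<bar>euler G x0 h (nat \<lfloor>t / h\<rfloor>) i - euler G x0 h (nat \<lfloor>s / h\<rfloor>) i - (t - s) * G x i\<bar>
         \<le> \<epsilon> * \<bar>t - s\<bar> + (\<epsilon> + \<bar>G x i\<bar>) * h"
proof -
  obtain J \<delta> where J: "finite J" and \<delta>: "0 < \<delta>"
    and near: "\<forall>y. (\<forall>j\<in>J. \<bar>y j - x j\<bar> < \<delta>) \<longrightarrow> \<bar>G y i - G x i\<bar> < \<epsilon>"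
    by (rule continuous_on_product_finite_coordinates[OF assms(1,3), of x])
  \<comment> \<open>\<open>M\<close> bounds the speed of the coordinates in \<open>J\<close>. Rounding to the grid may lengthen the
    interval by one step, so within a time \<open>2 * \<eta>\<close> these coordinates must use up only half of
    the tolerance; the other half is for the distance to \<open>x\<close> at time \<open>s\<close>.\<close>
  define M where "M = Max (insert 1 (C ` J))"
  have M: "1 \<le> M" "\<And>j. j \<in> J \<Longrightarrow> C j \<le> M"
    using J by (simp_all add: M_def)
  define \<eta> where "\<eta> = \<delta> / (4 * M)"
  have \<eta>: "0 < \<eta>" "M * (2 * \<eta>) = \<delta> / 2"
    using M(1) \<delta> by (auto simp: \<eta>_def)
  have "\<bar>euler G x0 h (nat \<lfloor>t / h\<rfloor>) i - euler G x0 h (nat \<lfloor>s / h\<rfloor>) i - (t - s) * G x i\<bar>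
         \<le> \<epsilon> * \<bar>t - s\<bar> + (\<epsilon> + \<bar>G x i\<bar>) * h"
    if h: "0 < h" "h \<le> \<eta>" and st: "0 \<le> s" "0 \<le> t" "\<bar>t - s\<bar> \<le> \<eta>"
      and close: "\<forall>j\<in>J. \<bar>euler G x0 h (nat \<lfloor>s / h\<rfloor>) j - x j\<bar> < \<delta> / 2" for h s t
  proof -
    let ?e = "euler G x0 h"
    define m where "m = nat \<lfloor>s / h\<rfloor>"
    define p where "p = nat \<lfloor>t / h\<rfloor>"
    have mp: "\<bar>h * (real p - real m) - (t - s)\<bar> \<le> h"
      using grid_index_bounds[OF st(1) h(1)] grid_index_bounds[OF st(2) h(1)]
      by (simp add: m_def p_def algebra_simps abs_le_iff)
    have len: "h * \<bar>real p - real m\<bar> \<le> \<bar>t - s\<bar> + h"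
    proof -
      have "h * \<bar>real p - real m\<bar> = \<bar>h * (real p - real m)\<bar>"
        using h by (simp add: abs_mult)
      then show ?thesis using mp by linarith
    qed
    have slope: "\<bar>G (?e k) i - G x i\<bar> \<le> \<epsilon>" if k: "min m p \<le> k" "k < max m p" for k
    proof -
      have "\<bar>?e k j - x j\<bar> < \<delta>" if "j \<in> J" for j
      proof -
        have "\<bar>?e k j - ?e m j - h * (real k - real m) * 0\<bar> \<le> C j * (h * \<bar>real k - real m\<bar>)"
          by (rule euler_slope) (use h bound in auto)
        also have "\<dots> \<le> M * (2 * \<eta>)"
        proof (rule mult_mono)
          have "h * \<bar>real k - real m\<bar> \<le> h * \<bar>real p - real m\<bar>"
            using k h by (intro mult_left_mono) auto
          then show "h * \<bar>real k - real m\<bar> \<le> 2 * \<eta>"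
            using len h st by linarith
        qed (use M that h in auto)
        finally have "\<bar>?e k j - ?e m j\<bar> \<le> \<delta> / 2"
          unfolding \<eta>(2) by simp
        then show ?thesis
          using bspec[OF close that] unfolding m_def by linarith
      qed
      then have "\<bar>G (?e k) i - G x i\<bar> < \<epsilon>" using near by blast
      then show ?thesis by simp
    qed
    have "\<bar>?e p i - ?e m i - h * (real p - real m) * G x i\<bar> \<le> \<epsilon> * (h * \<bar>real p - real m\<bar>)"
      by (rule euler_slope) (use h slope in auto)
    also have "\<dots> \<le> \<epsilon> * (\<bar>t - s\<bar> + h)"
      using len \<open>0 < \<epsilon>\<close> by simp
    finally have 1: "\<bar>?e p i - ?e m i - h * (real p - real m) * G x i\<bar> \<le> \<epsilon> * (\<bar>t - s\<bar> + h)" .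
    have "\<bar>(h * (real p - real m) - (t - s)) * G x i\<bar> \<le> h * \<bar>G x i\<bar>"
      unfolding abs_mult using mp by (intro mult_right_mono) auto
    with 1 show ?thesis
      unfolding m_def[symmetric] p_def[symmetric] by (simp add: algebra_simps)
  qed
  then show ?thesis using that[of J "\<delta> / 2" \<eta>] J \<delta> \<eta>(1) half_gt_zero by blast
qed

section \<open>Peano's theorem with infinitely many coordinates\<close>

text \<open>
  A field whose coordinates are bounded has a solution for all times; the bounds \<open>C i\<close> may be
  unbounded in \<open>i\<close>, so the field need not be bounded in any norm.
\<close>
theorem bounded_coordinates_global_solution:
  fixes G :: "('v \<Rightarrow> real) \<Rightarrow> 'v \<Rightarrow> real"
  assumes cont: "\<And>i. continuous_on UNIV (\<lambda>x. G x i)"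
    and bound: "\<And>x i. \<bar>G x i\<bar> \<le> C i"
  shows "\<exists>u. \<forall>i. u i 0 = x0 i \<and>
    (\<forall>t\<ge>0. (u i has_real_derivative G (\<lambda>j. u j t) i) (at t within {0..}))"
proof -
  define h where "h n = 1 / real (Suc n)" for n
  have h: "0 < h n" for n by (simp add: h_def)
  have h_lim: "h \<longlonglongrightarrow> 0" unfolding h_def by (rule LIMSEQ_Suc[OF lim_1_over_n])
  \<comment> \<open>Step functions serve as well as polygons: each jump is of the order of the step size.
    Coordinate and time are paired so that the compactness lemma treats both at once.\<close>
  define W where "W n = (\<lambda>(i, t). euler G x0 (h n) (nat \<lfloor>t / h n\<rfloor>) i)" for n
  have "\<bar>W n (i, t)\<bar> \<le> \<bar>x0 i\<bar> + C i * \<bar>t\<bar>" for n i t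
  proof -
    let ?k = "nat \<lfloor>t / h n\<rfloor>"
    have C: "0 \<le> C i" using bound[of undefined i] by linarith
    have "\<bar>euler G x0 (h n) ?k i - euler G x0 (h n) 0 i - h n * (real ?k - real 0) * 0\<bar>
        \<le> C i * (h n * \<bar>real ?k - real 0\<bar>)"
      by (rule euler_slope) (use h[of n] bound in auto)
    moreover have "h n * real ?k \<le> \<bar>t\<bar>"
    proof (cases "0 \<le> t")
      case True
      then show ?thesis using grid_index_bounds(1)[OF True h] by simp
    next
      case False
      then have "t / h n \<le> 0" using h[of n] by (simp add: divide_nonpos_pos)
      then have "?k = 0" by linarith
      then show ?thesis by simp
    qed
    then have "C i * (h n * real ?k) \<le> C i * \<bar>t\<bar>"
      using C by (rule mult_left_mono)
    ultimately show ?thesis by (simp add: W_def)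
  qed
  then have "\<bar>W n p\<bar> \<le> (\<lambda>(i, t). \<bar>x0 i\<bar> + C i * \<bar>t\<bar>) p" for n p
    by (cases p) simp
  then obtain \<F> w where \<F>: "\<F> \<le> sequentially" "\<F> \<noteq> bot"
    and W: "\<And>p. ((\<lambda>n. W n p) \<longlongrightarrow> w p) \<F>"
    by (rule pointwise_bounded_cluster_filter[where W = W]) (rule that)
  have h_lim': "(h \<longlongrightarrow> 0) \<F>"
    using \<F>(1) h_lim by (rule filterlim_mono[OF _ order_refl, rotated])
  have "w (i, 0) = x0 i" for i
  proof -
    have "(\<lambda>n. W n (i, 0)) = (\<lambda>n. x0 i)" by (simp add: W_def)
    then have "((\<lambda>n. x0 i) \<longlongrightarrow> w (i, 0)) \<F>" using W[of "(i, 0)"] by simp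
    then show ?thesis using \<F>(2) tendsto_const tendsto_unique by metis
  qed
  moreover have "((\<lambda>t. w (i, t)) has_real_derivative G (\<lambda>j. w (j, s)) i) (at s within {0..})"
    if s: "0 \<le> s" for i s
    unfolding has_field_derivative_def has_derivative_within_alt
  proof (intro conjI allI impI bounded_linear_mult_right)
    fix \<epsilon> :: real assume \<epsilon>: "0 < \<epsilon>"
    define x where "x = (\<lambda>j. w (j, s))"
    obtain J \<delta> \<eta> where J: "finite J" and \<delta>: "0 < \<delta>" and \<eta>: "0 < \<eta>"
      and slope: "\<forall>h s t. 0 < h \<and> h \<le> \<eta> \<and> 0 \<le> s \<and> 0 \<le> t \<and> \<bar>t - s\<bar> \<le> \<eta> \<and>
         (\<forall>j\<in>J. \<bar>euler G x0 h (nat \<lfloor>s / h\<rfloor>) j - x j\<bar> < \<delta>) \<longrightarrow>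
         \<bar>euler G x0 h (nat \<lfloor>t / h\<rfloor>) i - euler G x0 h (nat \<lfloor>s / h\<rfloor>) i - (t - s) * G x i\<bar>
           \<le> \<epsilon> * \<bar>t - s\<bar> + (\<epsilon> + \<bar>G x i\<bar>) * h"
      by (rule euler_local_slope[where G = G and x = x and ?x0.0 = x0, OF cont[of i] bound \<epsilon>])
    have "\<forall>\<^sub>F n in \<F>. \<forall>j\<in>J. \<bar>W n (j, s) - x j\<bar> < \<delta>"
      using J \<delta> W by (intro eventually_ball_finite)
        (auto simp: x_def tendsto_iff dist_real_def)
    moreover have "\<forall>\<^sub>F n in \<F>. h n < \<eta>"
      using h_lim' \<eta> by (rule order_tendstoD(2))
    ultimately have ev: "\<forall>\<^sub>F n in \<F>. \<bar>W n (i, t) - W n (i, s) - (t - s) * G x i\<bar>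
        \<le> \<epsilon> * \<bar>t - s\<bar> + (\<epsilon> + \<bar>G x i\<bar>) * h n"
      if "0 \<le> t" "\<bar>t - s\<bar> \<le> \<eta>" for t
      by eventually_elim (use slope h s that in \<open>simp add: W_def\<close>)
    \<comment> \<open>\<open>\<eta>\<close> does not depend on \<open>n\<close>, so the estimate passes to the limit at each \<open>t\<close>.\<close>
    have "\<bar>w (i, t) - w (i, s) - (t - s) * G x i\<bar> \<le> \<epsilon> * \<bar>t - s\<bar> + (\<epsilon> + \<bar>G x i\<bar>) * 0"
      if "0 \<le> t" "\<bar>t - s\<bar> \<le> \<eta>" for t
      using \<F>(2) _ _ ev[OF that]
      by (rule tendsto_le) (intro tendsto_intros W h_lim')+
    then show "\<exists>r>0. \<forall>t\<in>{0..}. norm (t - s) < r \<longrightarrow>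
        norm (w (i, t) - w (i, s) - G (\<lambda>j. w (j, s)) i * (t - s)) \<le> \<epsilon> * norm (t - s)"
      using \<eta> by (intro exI[of _ \<eta>]) (simp add: x_def mult.commute)
  qed
  ultimately show ?thesis
    by (intro exI[of _ "\<lambda>i t. w (i, t)"]) simp
qed

section \<open>Continuity of the extended curvature\<close>

text \<open>
  When a triangle inequality fails, the cosine-rule quotient leaves \<open>[-1, 1]\<close>: it is at most
  \<open>-1\<close> if \<open>a\<close> is the long side, and at least \<open>1\<close> if \<open>b\<close> or \<open>c\<close> is. The
  truncation then gives the prescribed values \<open>pi\<close> and \<open>0\<close>.
\<close>
lemma extended_angle_eq_arccos_clamp:
  assumes "0 < a" "0 < b" "0 < c"
  shows "extended_angle a b c = arccos (max (-1) (min 1 ((b\<^sup>2 + c\<^sup>2 - a\<^sup>2) / (2 * b * c))))"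
proof -
  let ?q = "(b\<^sup>2 + c\<^sup>2 - a\<^sup>2) / (2 * b * c)"
  have bc: "0 < 2 * b * c" using assms by simp
  have low: "?q \<le> -1 \<longleftrightarrow> b + c \<le> a"
  proof -
    have "?q \<le> -1 \<longleftrightarrow> (b + c)\<^sup>2 \<le> a\<^sup>2"
      unfolding pos_divide_le_eq[OF bc] by (auto simp: power2_eq_square algebra_simps)
    also have "\<dots> \<longleftrightarrow> b + c \<le> a"
      using assms by (subst power_mono_iff) auto
    finally show ?thesis .
  qed
  have high: "1 \<le> ?q \<longleftrightarrow> a + c \<le> b \<or> a + b \<le> c"
  proof -
    have "1 \<le> ?q \<longleftrightarrow> a\<^sup>2 \<le> (b - c)\<^sup>2"
      unfolding pos_le_divide_eq[OF bc] by (auto simp: power2_eq_square algebra_simps)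
    also have "\<dots> \<longleftrightarrow> \<bar>a\<bar> \<le> \<bar>b - c\<bar>"
      by (simp add: abs_le_square_iff)
    also have "\<dots> \<longleftrightarrow> a + c \<le> b \<or> a + b \<le> c"
      using assms by auto
    finally show ?thesis .
  qed
  consider "b + c \<le> a" | "\<not> b + c \<le> a" "a + c \<le> b \<or> a + b \<le> c"
    | "a < b + c" "b < a + c" "c < a + b"
    by linarith
  then show ?thesis
  proof cases
    case 1
    then show ?thesis using low by (simp add: extended_angle_def max_def min_def)
  next
    case 2
    then show ?thesis using high by (auto simp: extended_angle_def max_def min_def)
  next
    case 3
    then have "-1 < ?q" "?q < 1"
      using low high by linarith+
    then show ?thesis
      using 3 inner_angle_cosine_rule[OF assms(2,3) 3]
      by (simp add: extended_angle_def max_def min_def)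
  qed
qed

lemma extended_angle_bounds:
  assumes "0 < a" "0 < b" "0 < c"
  shows "0 \<le> extended_angle a b c" "extended_angle a b c \<le> pi"
  unfolding extended_angle_eq_arccos_clamp[OF assms] by (auto intro!: arccos_lbound arccos_ubound)

lemma continuous_on_extended_angle:
  assumes "continuous_on A a" "continuous_on A b" "continuous_on A c"
    and "\<And>x. x \<in> A \<Longrightarrow> 0 < a x \<and> 0 < b x \<and> 0 < c x"
  shows "continuous_on A (\<lambda>x. extended_angle (a x) (b x) (c x))"
proof -
  have "continuous_on A (\<lambda>x. arccos (max (-1)
      (min 1 (((b x)\<^sup>2 + (c x)\<^sup>2 - (a x)\<^sup>2) / (2 * b x * c x)))))"
    by (intro continuous_intros assms(1-3)) (use assms(4) in force)+
  then show ?thesis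
    by (rule continuous_on_eq) (use assms(4) in \<open>simp add: extended_angle_eq_arccos_clamp\<close>)
qed

lemma continuous_on_conformal_change:
  "continuous_on UNIV (\<lambda>u. conformal_change u d e)"
  unfolding conformal_change_def by (intro continuous_intros) auto

lemma corner_angle_conformal_change:
  assumes K: "simplicial_2complex V E F" and d: "\<forall>e\<in>E. 0 < d e"
    and f: "f \<in> F" "i \<in> f"
  shows "continuous_on UNIV (\<lambda>u. corner_angle (conformal_change u d) f i)"
    and "0 \<le> corner_angle (conformal_change u d) f i"
    and "corner_angle (conformal_change u d) f i \<le> pi"
proof -
  have "card f = 3" and edges: "\<And>e. e \<subseteq> f \<Longrightarrow> card e = 2 \<Longrightarrow> e \<in> E"
    using K f(1) unfolding simplicial_2complex_def by auto
  then have "card (f - {i}) = 2" using f(2) by simp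
  then obtain j k where jk: "f - {i} = {j, k}" "j \<noteq> k"
    unfolding card_2_iff by auto
  then have f_eq: "f = {i, j, k}" and ne: "i \<noteq> j" "i \<noteq> k" using f(2) by auto
  have pos: "0 < conformal_change u d {j, k}" "0 < conformal_change u d {i, k}"
    "0 < conformal_change u d {i, j}" for u
    unfolding conformal_change_def using ne jk(2) f_eq by (auto intro!: mult_pos_pos d[rule_format] edges)
  have eq: "corner_angle (conformal_change u d) f i = extended_angle
      (conformal_change u d {j, k}) (conformal_change u d {i, k}) (conformal_change u d {i, j})" for u
    using \<open>card f = 3\<close> pos unfolding f_eq by (intro corner_angle_eq)
  show "continuous_on UNIV (\<lambda>u. corner_angle (conformal_change u d) f i)"
    unfolding eq by (intro continuous_on_extended_angle continuous_on_conformal_change) (simp add: pos)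
  show "0 \<le> corner_angle (conformal_change u d) f i" "corner_angle (conformal_change u d) f i \<le> pi"
    unfolding eq by (intro extended_angle_bounds pos)+
qed

lemma extended_curvature_bound:
  assumes "simplicial_2complex V E F" "\<forall>e\<in>E. 0 < d e"
  shows "\<bar>extended_curvature F d u i\<bar> \<le> 2 * pi + card {f \<in> F. i \<in> f} * pi"
proof -
  let ?S = "\<Sum>f\<in>{f \<in> F. i \<in> f}. corner_angle (conformal_change u d) f i"
  have "0 \<le> ?S" "?S \<le> card {f \<in> F. i \<in> f} * pi"
    by (rule sum_nonneg sum_bounded_above,
        simp add: corner_angle_conformal_change(2,3)[OF assms])+
  then show ?thesis
    unfolding extended_curvature_def using pi_gt_zero by linarith
qed

lemma continuous_on_extended_curvature:
  assumes "simplicial_2complex V E F" "\<forall>e\<in>E. 0 < d e"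
  shows "continuous_on UNIV (\<lambda>u. extended_curvature F d u i)"
  unfolding extended_curvature_def
  by (intro continuous_intros corner_angle_conformal_change(1)[OF assms]) auto

section \<open>Existence of the flow\<close>

theorem theorem1p2:
  fixes V :: "'v set" and E F :: "'v set set" and S :: "'s topology"
    and d :: "'v set \<Rightarrow> real"
  assumes "surface S"
    and "triangulation_of V E F S"
    and "infinite V"
    and "locally_finite_complex V E F"
    and "without_boundary E F"
    and "PL_metric E F d"
  shows "\<exists>u :: 'v \<Rightarrow> real \<Rightarrow> real. global_extended_Yamabe_flow V F d u"
proof -
  have K: "simplicial_2complex V E F"
    using assms(2) by (simp add: triangulation_of_def)
  have d: "\<forall>e\<in>E. 0 < d e"
    using assms(6) by (simp add: PL_metric_def)
  \<comment> \<open>The equation is solved for all \<open>i :: 'v\<close>. Outside \<open>V\<close> no triangle contains \<open>i\<close>, so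
    there the right-hand side is the constant \<open>- 2 * pi\<close>.\<close>
  have "\<exists>u. \<forall>i. u i 0 = 0 \<and> (\<forall>t\<ge>0.
      (u i has_real_derivative - extended_curvature F d (\<lambda>j. u j t) i) (at t within {0..}))"
  proof (rule bounded_coordinates_global_solution)
    show "continuous_on UNIV (\<lambda>u. - extended_curvature F d u i)" for i
      by (intro continuous_on_minus continuous_on_extended_curvature[OF K d])
    show "\<bar>- extended_curvature F d u i\<bar> \<le> 2 * pi + card {f \<in> F. i \<in> f} * pi" for u i
      using extended_curvature_bound[OF K d] by simp
  qed
  then obtain u where u0: "\<And>i. u i 0 = 0"
    and du: "\<And>i t. 0 \<le> t \<Longrightarrow>
      (u i has_real_derivative - extended_curvature F d (\<lambda>j. u j t) i) (at t within {0..})"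
    by metis
  have "continuous_on {0..} (\<lambda>t i. u i t)"
    by (intro continuous_on_coordinatewise_then_product)
      (use du in \<open>auto simp: continuous_on_eq_continuous_within intro: DERIV_continuous\<close>)
  then have "continuous_on {0..} (\<lambda>t. - extended_curvature F d (\<lambda>j. u j t) i)" for i
    by (intro continuous_on_minus
        continuous_on_compose2[OF continuous_on_extended_curvature[OF K d]]) auto
  then have "C1_on_nonneg (u i)" for i
    unfolding C1_on_nonneg_def using du
    by (intro exI[of _ "\<lambda>t. - extended_curvature F d (\<lambda>j. u j t) i"]) blast
  then show ?thesis
    unfolding global_extended_Yamabe_flow_def using u0 du by blast
qed

end
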